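(* Let $\Delta$ be a unit-interval simplicial complex on $[n]$, and let $\Gamma=\mathrm{Ind}(\Delta)$. The ideal $(t)\subset R_\Gamma$ is radical if and only if $\dim(\Delta)=1$.
   Context: For a pure $(d-1)$-dimensional simplicial complex $\Delta$ on vertex set $[n]=\{1,\dots,n\}$: a clique is a subset $C\subseteq[n]$ all of whose $d$-subsets are facets of $\Delta$; $\mathrm{Ind}(\Delta)$ is the simplicial complex of all subsets of $[n]$ containing no facet of $\Delta$. $\Delta$ is a unit-interval simplicial complex if it is pure and for every facet $\{i_1<\cdots<i_d\}$ the interval $[i_1,i_d]=\{i_1,i_1+1,\dots,i_d\}$ is a clique of $\Delta$. Let $K$ be a field, $S=K[x_1,\dots,x_n]$, $\mathbf{x}_F=\prod_{i\in F}x_i$ ($\mathbf{x}_\emptyset=1$), and $R_\Gamma=K[\mathbf{x}_Ft:F\in\Gamma]\subset S[t]$ (so $t=\mathbf{x}_\emptyset t\in R_\Gamma$).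
   Formalization: The formal theorem assumes dim(Δ) ≥ 1. In dimension 0 the claim fails: if the facets are {1},…,{n}, then Γ={∅}, R_Γ=K[t] and (t) is prime, hence radical, though dim(Δ)=0; for Δ={∅} the complex Γ is void and t is not in R_Γ. *)

theory Defs
  imports
    "HOL-Algebra.Generated_Rings"
    "HOL-Computational_Algebra.Polynomial"
    "HOL-Library.Poly_Mapping"
begin

section \<open>Simplicial complexes on \<open>[n] = {1..n}\<close>\<close>

text \<open>As usual, it is not required that every \<open>i \<in> {1..n}\<close> be a vertex of the complex.\<close>

definition simplicial_complex_on :: "nat \<Rightarrow> nat set set \<Rightarrow> bool" where
  "simplicial_complex_on n \<Delta> \<longleftrightarrow>
     \<Delta> \<subseteq> Pow {1..n} \<and> (\<forall>F\<in>\<Delta>. \<forall>G. G \<subseteq> F \<longrightarrow> G \<in> \<Delta>)"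

definition facets :: "nat set set \<Rightarrow> nat set set" where
  "facets \<Delta> = {F \<in> \<Delta>. \<forall>G\<in>\<Delta>. F \<subseteq> G \<longrightarrow> G = F}"

text \<open>Integer-valued, so that \<open>complex_dim {{}} = -1\<close>; only meaningful if \<open>\<Delta>\<close> is finite and
  nonempty.\<close>

definition complex_dim :: "nat set set \<Rightarrow> int" where
  "complex_dim \<Delta> = int (Max (card ` \<Delta>)) - 1"

definition pure_complex :: "nat set set \<Rightarrow> bool" where
  "pure_complex \<Delta> \<longleftrightarrow>
     \<Delta> \<noteq> {} \<and> (\<forall>F\<in>facets \<Delta>. int (card F) - 1 = complex_dim \<Delta>)"

text \<open>With \<open>d = complex_dim \<Delta> + 1\<close>, all \<open>d\<close>-subsets of \<open>C\<close> are facets.\<close>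

definition clique :: "nat \<Rightarrow> nat set set \<Rightarrow> nat set \<Rightarrow> bool" where
  "clique n \<Delta> C \<longleftrightarrow>
     C \<subseteq> {1..n} \<and>
     (\<forall>F. F \<subseteq> C \<and> int (card F) = complex_dim \<Delta> + 1 \<longrightarrow> F \<in> facets \<Delta>)"

definition unit_interval_complex :: "nat \<Rightarrow> nat set set \<Rightarrow> bool" where
  "unit_interval_complex n \<Delta> \<longleftrightarrow>
     simplicial_complex_on n \<Delta> \<and> pure_complex \<Delta> \<and>
     (\<forall>F\<in>facets \<Delta>. clique n \<Delta> {Min F..Max F})"

definition Ind :: "nat \<Rightarrow> nat set set \<Rightarrow> nat set set" where
  "Ind n \<Delta> = {G. G \<subseteq> {1..n} \<and> (\<forall>F\<in>facets \<Delta>. \<not> F \<subseteq> G)}"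


section \<open>The toric ring of a simplicial complex\<close>

text \<open>Polynomials over \<open>'k\<close> in variables \<open>x\<^sub>i\<close> for all \<open>i :: nat\<close>, as finitely supported maps from
  exponent vectors to coefficients. For a complex on \<open>[n]\<close> only \<open>x\<^sub>1, \<dots>, x\<^sub>n\<close> occur below, so the
  subalgebra generated is the same as in \<open>K[x\<^sub>1, \<dots>, x\<^sub>n][t]\<close>.\<close>

type_synonym 'k S = "(nat \<Rightarrow>\<^sub>0 nat) \<Rightarrow>\<^sub>0 'k"

definition x_var :: "nat \<Rightarrow> 'k::field S" where
  "x_var i = Poly_Mapping.single (Poly_Mapping.single i 1) 1"

definition x_prod :: "nat set \<Rightarrow> 'k::field S" where
  "x_prod F = (\<Prod>i\<in>F. x_var i)"

definition t_var :: "'k::field S poly" where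
  "t_var = [:0, 1:]"

definition const :: "'k::field \<Rightarrow> 'k S poly" where
  "const c = [:Poly_Mapping.single 0 c:]"

definition S_t :: "'k::field S poly ring" where
  "S_t = \<lparr>carrier = UNIV, monoid.mult = (*), one = 1, ring.zero = 0, add = (+)\<rparr>"

text \<open>The \<open>K\<close>-subalgebra generated by a set is the subring generated by this set together with
  the constants.\<close>

definition toric_ring :: "nat set set \<Rightarrow> 'k::field S poly ring" where
  "toric_ring \<Gamma> =
     S_t \<lparr>carrier := generate_ring S_t (range const \<union> {[:x_prod F:] * t_var | F. F \<in> \<Gamma>})\<rparr>"


section \<open>Radical ideals\<close>

definition radical_of :: "('a, 'b) ring_scheme \<Rightarrow> 'a set \<Rightarrow> 'a set" where
  "radical_of R I = {a \<in> carrier R. \<exists>m::nat. m > 0 \<and> a [^]\<^bsub>R\<^esub> m \<in> I}"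

definition radical_ideal :: "'a set \<Rightarrow> ('a, 'b) ring_scheme \<Rightarrow> bool" where
  "radical_ideal I R \<longleftrightarrow> ideal I R \<and> radical_of R I = I"

end

theory Submission
  imports Defs
begin

text \<open>For a weight \<open>u\<close> on the variables with \<open>\<Sum>i\<in>F. u i \<le> 1\<close> for all \<open>F \<in> \<Gamma>\<close>, the substitution \<open>x\<^sub>i \<mapsto> x\<^sub>i t\<^bsup>u i\<^esup>\<close>
  is injective and has \<open>R\<^sub>\<Gamma>\<close> in its image. Pulling \<open>p\<^sup>m \<in> (t)\<close> back along it, the primality of \<open>t\<close> in
  \<open>S[t]\<close> shows that \<open>k > \<Sum>\<^sub>i u i a i\<close> for all monomials \<open>x\<^sup>a t\<^sup>k\<close> of \<open>p\<close>. In dimension 1 these inequalities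
  (for indicators of interval cliques) suffice for \<open>x\<^sup>a t\<^bsup>k-1\<^esup> \<in> R\<^sub>\<Gamma>\<close>, because a weighted unit interval
  graph can be coloured with as many colours as its heaviest clique. In dimension at least 2, take
  distinct vertices \<open>a, b\<close> of a facet \<open>F\<close>: then \<open>x\<^sub>F t \<notin> R\<^sub>\<Gamma>\<close>, but \<open>z = x\<^sub>F t\<^sup>2 \<in> R\<^sub>\<Gamma>\<close> has
  \<open>z\<^sup>2 = t \<cdot> x\<^bsub>F-a\<^esub>t \<cdot> x\<^bsub>F-b\<^esub>t \<cdot> x\<^bsub>ab\<^esub>t\<close>.\<close>

declare One_nat_def [simp del]

abbreviation (input) "lookup \<equiv> Poly_Mapping.lookup"
abbreviation (input) "keys \<equiv> Poly_Mapping.keys"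
abbreviation (input) "single \<equiv> Poly_Mapping.single"

section \<open>The toric ring\<close>

lemma cring_S_t: "cring (S_t :: 'k::field S poly ring)"
proof (intro cringI abelian_groupI comm_monoidI)
  fix x :: "'k S poly"
  show "\<exists>y\<in>carrier S_t. y \<oplus>\<^bsub>S_t\<^esub> x = \<zero>\<^bsub>S_t\<^esub>"
    by (rule bexI[of _ "- x"]) (simp_all add: S_t_def)
qed (simp_all add: S_t_def algebra_simps)

lemma S_t_simps [simp]:
  "carrier S_t = UNIV" "x \<otimes>\<^bsub>S_t\<^esub> y = x * y" "\<one>\<^bsub>S_t\<^esub> = 1" "\<zero>\<^bsub>S_t\<^esub> = 0" "x \<oplus>\<^bsub>S_t\<^esub> y = x + y"
  by (simp_all add: S_t_def)

lemma S_t_a_inv [simp]: "\<ominus>\<^bsub>S_t\<^esub> (x :: 'k::field S poly) = - x"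
proof -
  interpret cring "S_t :: 'k S poly ring" by (rule cring_S_t)
  show ?thesis by (rule minus_equality) simp_all
qed

lemma toric_ring_simps [simp]:
  "x \<otimes>\<^bsub>toric_ring \<Gamma>\<^esub> y = x * y" "\<one>\<^bsub>toric_ring \<Gamma>\<^esub> = 1"
  by (simp_all add: toric_ring_def)

lemma cring_toric_ring: "cring (toric_ring \<Gamma> :: 'k::field S poly ring)"
proof -
  interpret S: cring "S_t :: 'k S poly ring" by (rule cring_S_t)
  show ?thesis
    unfolding toric_ring_def
    by (subst S.subcring_iff[symmetric])
      (auto intro!: S.subcringI' S.generate_ring_is_subring)
qed

lemma toric_ring_pow [simp]: "x [^]\<^bsub>toric_ring \<Gamma>\<^esub> (m::nat) = x ^ m"
proof -
  interpret cring "toric_ring \<Gamma> :: 'k::field S poly ring" by (rule cring_toric_ring)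
  show ?thesis by (induction m) (simp_all add: mult.commute)
qed

lemma toric_ring_induct [consumes 1, case_names const gen uminus add mult]:
  assumes "p \<in> carrier (toric_ring \<Gamma>)"
    and "\<And>c. P (const c)"
    and "\<And>F. F \<in> \<Gamma> \<Longrightarrow> P ([:x_prod F:] * t_var)"
    and "\<And>p. P p \<Longrightarrow> P (- p)"
    and "\<And>p q. P p \<Longrightarrow> P q \<Longrightarrow> P (p + q)"
    and "\<And>p q. P p \<Longrightarrow> P q \<Longrightarrow> P (p * q)"
  shows "P p"
proof -
  have "p \<in> generate_ring S_t (range const \<union> {[:x_prod F:] * t_var | F. F \<in> \<Gamma>})"
    using assms(1) by (simp add: toric_ring_def)
  then show ?thesis
  proof (induction rule: generate_ring.induct)
    case one
    have "(1 :: 'a S poly) = const 1" by (simp add: const_def one_pCons)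
    then show ?case using assms(2)[of 1] by simp
  qed (use assms in auto)
qed

lemma
  shows toric_ring_const: "const c \<in> carrier (toric_ring \<Gamma>)"
    and toric_ring_gen: "F \<in> \<Gamma> \<Longrightarrow> [:x_prod F:] * t_var \<in> carrier (toric_ring \<Gamma>)"
    and toric_ring_add: "p \<in> carrier (toric_ring \<Gamma>) \<Longrightarrow> q \<in> carrier (toric_ring \<Gamma>) \<Longrightarrow>
          p + q \<in> carrier (toric_ring \<Gamma>)"
    and toric_ring_mult: "p \<in> carrier (toric_ring \<Gamma>) \<Longrightarrow> q \<in> carrier (toric_ring \<Gamma>) \<Longrightarrow>
          p * q \<in> carrier (toric_ring \<Gamma>)"
  using generate_ring.eng_add[of p S_t _ q] generate_ring.eng_mult[of p S_t _ q]
  by (auto simp: toric_ring_def intro: generate_ring.incl)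

lemma toric_ring_sum:
  "(\<And>i. i \<in> A \<Longrightarrow> f i \<in> carrier (toric_ring \<Gamma>)) \<Longrightarrow> sum f A \<in> carrier (toric_ring \<Gamma>)"
  using toric_ring_const[of 0]
  by (induction A rule: infinite_finite_induct) (auto simp: const_def intro: toric_ring_add)

lemma toric_ring_prod:
  "(\<And>i. i \<in> A \<Longrightarrow> f i \<in> carrier (toric_ring \<Gamma>)) \<Longrightarrow> prod f A \<in> carrier (toric_ring \<Gamma>)"
  using toric_ring_const[of 1]
  by (induction A rule: infinite_finite_induct)
    (auto simp: const_def one_pCons intro: toric_ring_mult)

lemma PIdl_t_var: "PIdl\<^bsub>toric_ring \<Gamma>\<^esub> t_var = {p * t_var | p. p \<in> carrier (toric_ring \<Gamma>)}"
  by (simp add: cgenideal_def)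

lemma t_var_mult: "p * t_var = pCons 0 p"
  by (simp add: t_var_def)

lemma t_var_in_toric_ring: "{} \<in> \<Gamma> \<Longrightarrow> t_var \<in> carrier (toric_ring \<Gamma>)"
  using toric_ring_gen[of "{}" \<Gamma>] by (simp add: x_prod_def one_pCons flip: one_pCons)


section \<open>Monomials\<close>

lemma lookup_pCons_0: "lookup (coeff (pCons 0 p) k) a = (if k = 0 then 0 else lookup (coeff p (k - 1)) a)"
  by (auto simp: coeff_pCons split: nat.split)

lemma S_t_eqI:
  fixes p q :: "'k::field S poly"
  assumes "\<And>k a. lookup (coeff p k) a = lookup (coeff q k) a"
  shows "p = q"
  using assms by (auto intro!: poly_eqI poly_mapping_eqI)

lemma poly_mapping_eq_sum_single:
  "(s :: 'a \<Rightarrow>\<^sub>0 'b::comm_monoid_add) = (\<Sum>a\<in>keys s. single a (lookup s a))"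
  by (rule poly_mapping_eqI)
    (simp add: lookup_sum lookup_single when_def sum.delta in_keys_iff)

lemma S_t_eq_sum_monom:
  fixes p :: "'k::field S poly"
  shows "p = (\<Sum>k\<le>degree p. \<Sum>a\<in>keys (coeff p k). monom (single a (lookup (coeff p k) a)) k)"
proof -
  have "p = (\<Sum>k\<le>degree p. monom (coeff p k) k)"
    by (simp add: poly_as_sum_of_monoms)
  also have "\<dots> = (\<Sum>k\<le>degree p. \<Sum>a\<in>keys (coeff p k). monom (single a (lookup (coeff p k) a)) k)"
    by (simp flip: monom_sum poly_mapping_eq_sum_single)
  finally show ?thesis .
qed

lemma prod_single: "(\<Prod>i\<in>A. single (f i) 1) = single (sum f A) 1"
  by (induction A rule: infinite_finite_induct) (simp_all add: mult_single)

lemma x_prod_eq_single: "x_prod F = single (\<Sum>i\<in>F. single i 1) 1"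
  by (simp add: x_prod_def x_var_def prod_single)


section \<open>Monomial valuations\<close>

definition wt :: "(nat \<Rightarrow> nat) \<Rightarrow> (nat \<Rightarrow>\<^sub>0 nat) \<Rightarrow> nat" where
  "wt u a = (\<Sum>i\<in>keys a. u i * lookup a i)"

lemma wt_superset: "finite A \<Longrightarrow> keys a \<subseteq> A \<Longrightarrow> wt u a = (\<Sum>i\<in>A. u i * lookup a i)"
  unfolding wt_def by (rule sum.mono_neutral_left) (auto simp: in_keys_iff)

lemma wt_0 [simp]: "wt u 0 = 0"
  by (simp add: wt_def)

lemma wt_add: "wt u (a + b) = wt u a + wt u b"
  by (simp add: wt_superset[of "keys a \<union> keys b"] keys_add lookup_add algebra_simps sum.distrib)

lemma wt_single: "wt u (single i n) = u i * n"
  by (simp add: wt_def)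

lemma wt_sum: "wt u (sum f A) = (\<Sum>i\<in>A. wt u (f i))"
  by (induction A rule: infinite_finite_induct) (simp_all add: wt_add)

text \<open>The restriction to S of the substitution x_i -> x_i t^(u i), given monomial by monomial
  so that coefficients of the image can be read off directly.\<close>

definition twist_coeff :: "(nat \<Rightarrow> nat) \<Rightarrow> 'k::field S \<Rightarrow> 'k S poly" where
  "twist_coeff u s = (\<Sum>a\<in>keys s. monom (single a (lookup s a)) (wt u a))"

lemma lookup_twist_coeff:
  "lookup (coeff (twist_coeff u s) k) a = (if k = wt u a then lookup s a else 0)"
proof -
  have "lookup (coeff (twist_coeff u s) k) a =
      (\<Sum>b\<in>keys s. if b = a then (if k = wt u a then lookup s a else 0) else 0)"
    unfolding twist_coeff_def coeff_sum lookup_sum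
    by (intro sum.cong) (auto simp: lookup_single when_def)
  then show ?thesis by (simp add: sum.delta in_keys_iff)
qed

lemma twist_coeff_0 [simp]: "twist_coeff u 0 = 0"
  by (simp add: twist_coeff_def)

lemma twist_coeff_add: "twist_coeff u (s + s') = twist_coeff u s + twist_coeff u s'"
  by (rule S_t_eqI) (simp add: lookup_twist_coeff lookup_add)

lemma twist_coeff_sum: "twist_coeff u (sum f A) = (\<Sum>i\<in>A. twist_coeff u (f i))"
  by (induction A rule: infinite_finite_induct) (simp_all add: twist_coeff_add)

lemma twist_coeff_single: "twist_coeff u (single a c) = monom (single a c) (wt u a)"
  by (auto simp: twist_coeff_def)

text \<open>By bilinearity it is enough to multiply two monomials, and there the claim is the
  additivity of the weight.\<close>

lemma twist_coeff_mult: "twist_coeff u (s * s') = twist_coeff u s * twist_coeff u s'"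
proof -
  have "twist_coeff u (s * s') = twist_coeff u ((\<Sum>a\<in>keys s. single a (lookup s a)) *
      (\<Sum>b\<in>keys s'. single b (lookup s' b)))"
    by (simp flip: poly_mapping_eq_sum_single)
  also have "\<dots> = twist_coeff u s * twist_coeff u s'"
    by (simp add: sum_product mult_single twist_coeff_sum twist_coeff_single mult_monom wt_add
        twist_coeff_def[of u s] twist_coeff_def[of u s'])
  finally show ?thesis .
qed

text \<open>The substitution \<open>x\<^sub>i \<mapsto> x\<^sub>i t\<^bsup>u i\<^esup>\<close>, \<open>t \<mapsto> t\<close>.\<close>

definition twist :: "(nat \<Rightarrow> nat) \<Rightarrow> 'k::field S poly \<Rightarrow> 'k S poly" where
  "twist u p = poly (map_poly (twist_coeff u) p) t_var"

lemma twist_0 [simp]: "twist u 0 = 0"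
  by (simp add: twist_def)

lemma twist_pCons: "twist u (pCons s p) = twist_coeff u s + pCons 0 (twist u p)"
  by (simp add: twist_def map_poly_pCons t_var_def)

lemma twist_add: "twist u (p + q) = twist u p + twist u q"
proof -
  have "map_poly (twist_coeff u) (p + q) = map_poly (twist_coeff u) p + map_poly (twist_coeff u) q"
    by (rule poly_eqI) (simp add: coeff_map_poly twist_coeff_add)
  then show ?thesis by (simp add: twist_def)
qed

lemma twist_mult: "twist u (p * q) = twist u p * twist u q"
proof -
  have "map_poly (twist_coeff u) (p * q) = map_poly (twist_coeff u) p * map_poly (twist_coeff u) q"
    by (rule poly_eqI) (simp add: coeff_map_poly coeff_mult twist_coeff_sum twist_coeff_mult)
  then show ?thesis by (simp add: twist_def)
qed

lemma twist_1: "twist u 1 = 1"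
  using twist_coeff_single[of u 0 1] by (simp add: one_pCons twist_pCons monom_0)

lemma twist_uminus: "twist u (- p) = - twist u p"
  using twist_add[of u p "- p"] by (simp add: eq_neg_iff_add_eq_0 add.commute)

lemma twist_power: "twist u (p ^ m) = twist u p ^ m"
  by (induction m) (simp_all add: twist_1 twist_mult)

text \<open>The monomial x^a t^j is sent to x^a t^(j + wt u a), so x^a t^k comes from exactly one
  monomial, or from none if k is below the weight.\<close>

lemma lookup_twist:
  "lookup (coeff (twist u p) k) a = (if wt u a \<le> k then lookup (coeff p (k - wt u a)) a else 0)"
proof (induction p arbitrary: k)
  case (pCons s p)
  show ?case
    by (auto simp: twist_pCons lookup_add lookup_twist_coeff lookup_pCons_0 pCons.IH coeff_pCons
        Suc_diff_le diff_Suc split: nat.splits if_splits)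
qed simp

lemma inj_twist: "inj (twist u)"
proof (rule injI, rule S_t_eqI)
  fix p q :: "'k::field S poly" and k a
  assume "twist u p = twist u q"
  then have "lookup (coeff (twist u p) (k + wt u a)) a = lookup (coeff (twist u q) (k + wt u a)) a"
    by simp
  then show "lookup (coeff p k) a = lookup (coeff q k) a"
    by (simp add: lookup_twist)
qed

text \<open>The range is a subring containing the constants. A generator x_F t is the image of
  itself if F has weight 0, and of x_F if F has weight 1.\<close>

lemma toric_ring_subset_range_twist:
  assumes u: "\<And>F. F \<in> \<Gamma> \<Longrightarrow> sum u F \<le> 1"
    and "p \<in> carrier (toric_ring \<Gamma>)"
  shows "p \<in> range (twist u)"
  using assms(2)
proof (induction rule: toric_ring_induct)
  case (const c)
  have "const c = twist u (const c)"
    by (simp add: const_def twist_pCons twist_coeff_single monom_0)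
  then show ?case by blast
next
  case (gen F)
  let ?a = "\<Sum>i\<in>F. single i (1::nat)"
  have "wt u ?a = sum u F" by (simp add: wt_sum wt_single)
  with u[OF gen] consider "wt u ?a = 0" | "wt u ?a = 1" by linarith
  then show ?case
  proof cases
    case 1
    then have "[:x_prod F:] * t_var = twist u ([:x_prod F:] * t_var)"
      by (simp add: t_var_mult twist_pCons x_prod_eq_single twist_coeff_single monom_0)
    then show ?thesis by blast
  next
    case 2
    then have "[:x_prod F:] * t_var = twist u [:x_prod F:]"
      by (simp add: t_var_mult twist_pCons x_prod_eq_single twist_coeff_single monom_Suc monom_0 One_nat_def)
    then show ?thesis by blast
  qed
next
  case (uminus p)
  then show ?case by (auto simp flip: twist_uminus)
next
  case (add p q)
  then show ?case by (auto simp flip: twist_add)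
next
  case (mult p q)
  then show ?case by (auto simp flip: twist_mult)
qed

lemma wt_less_of_power_in_PIdl:
  fixes p :: "'k::field S poly"
  assumes u: "\<And>F. F \<in> \<Gamma> \<Longrightarrow> sum u F \<le> 1"
    and p: "p \<in> carrier (toric_ring \<Gamma>)"
    and pm: "p ^ m = g * t_var" "g \<in> carrier (toric_ring \<Gamma>)"
    and nz: "lookup (coeff p k) a \<noteq> 0"
  shows "wt u a < k"
proof -
  obtain q where q: "p = twist u q"
    using toric_ring_subset_range_twist[OF u p] by blast
  obtain h where h: "g = twist u h"
    using toric_ring_subset_range_twist[OF u pm(2)] by blast
  \<comment> \<open>The substitution fixes t, so it sends h t to g t.\<close>
  have "twist u (q ^ m) = twist u (pCons 0 h)"
    using pm(1) by (simp add: q h twist_power twist_pCons t_var_mult)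
  then have "q ^ m = pCons 0 h"
    by (rule injD[OF inj_twist])
  \<comment> \<open>Setting t = 0 in the domain S[t] shows that \<open>q\<close> has no term of
    t-degree 0. A term x^a t^k of \<open>p\<close> stems from x^a t^(k - wt u a) in
    \<open>q\<close>, whose t-degree must then be positive.\<close>
  then have "coeff q 0 ^ m = 0"
    by (simp flip: coeff_0_power)
  then have "coeff q 0 = 0"
    by simp
  with nz show ?thesis
    by (auto simp: q lookup_twist le_less split: if_splits)
qed


section \<open>Monomials of the toric ring\<close>

lemma prod_pCons: "(\<Prod>i\<in>A. [:f i:]) = [:prod f A:]"
  by (induction A rule: infinite_finite_induct) (simp_all add: one_pCons mult.commute)

text \<open>Each residue class of positions mod k has distinct letters and so contributes one
  generator. Empty classes contribute t, which brings the t-degree up to exactly k.\<close>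

lemma monom_in_toric_ring_of_word:
  assumes "k > 0"
    and inj: "\<And>p q. p < q \<Longrightarrow> q < N \<Longrightarrow> p mod k = q mod k \<Longrightarrow> f p \<noteq> f q"
    and mem: "\<And>r. r < k \<Longrightarrow> f ` {p\<in>{..<N}. p mod k = r} \<in> \<Gamma>"
  shows "monom (single (\<Sum>p<N. single (f p) 1) c) k \<in> carrier (toric_ring \<Gamma>)"
proof -
  let ?P = "\<lambda>r. {p\<in>{..<N}. p mod k = r}"
  have inj': "inj_on f (?P r)" for r
    using inj by (intro linorder_inj_onI) auto
  have "(\<Prod>r<k. x_prod (f ` ?P r) :: 'a S) = (\<Prod>r<k. single (\<Sum>p\<in>?P r. single (f p) 1) 1)"
    by (simp only: x_prod_eq_single sum.reindex[OF inj'] o_def)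
  also have "\<dots> = single (\<Sum>r<k. \<Sum>p\<in>?P r. single (f p) 1) 1"
    by (rule prod_single)
  also have "(\<Sum>r<k. \<Sum>p\<in>?P r. single (f p) (1::nat)) = (\<Sum>p<N. single (f p) 1)"
    using \<open>k > 0\<close> by (intro sum.group) auto
  finally have prod_eq: "(\<Prod>r<k. x_prod (f ` ?P r) :: 'a S) = single (\<Sum>p<N. single (f p) 1) 1" .
  have "(\<Prod>r<k. [:x_prod (f ` ?P r) :: 'a S:] * t_var) = [:single (\<Sum>p<N. single (f p) 1) 1:] * t_var ^ k"
    by (simp only: prod.distrib prod_pCons prod_constant card_lessThan prod_eq)
  then have "monom (single (\<Sum>p<N. single (f p) 1) c) k =
      const c * (\<Prod>r<k. [:x_prod (f ` ?P r):] * t_var)"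
    by (simp only: const_def) (simp add: t_var_def mult_single monom_altdef)
  also have "\<dots> \<in> carrier (toric_ring \<Gamma>)"
    using mem by (intro toric_ring_mult toric_ring_const toric_ring_prod toric_ring_gen) auto
  finally show ?thesis .
qed

text \<open>In a sorted word the letters between two positions stay in the interval spanned by the
  two end letters, which is what the colouring by residues relies on.\<close>

lemma exists_sorted_word:
  fixes a :: "nat \<Rightarrow>\<^sub>0 nat"
  obtains xs where "sorted xs" "a = (\<Sum>p<length xs. single (xs ! p) 1)"
proof
  define M where "M = (\<Sum>i\<in>keys a. replicate_mset (lookup a i) i)"
  define xs where "xs = sorted_list_of_multiset M"
  show "sorted xs" by (simp add: xs_def)
  have "(\<Sum>p<length xs. single (xs ! p) (1::nat)) = sum_list (map (\<lambda>i. single i 1) xs)"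
    by (simp add: sum_list_sum_nth atLeast0LessThan)
  also have "\<dots> = (\<Sum>i\<in>#M. single i 1)"
    by (simp add: xs_def sum_mset_sum_list[symmetric] mset_map del: sum_mset_sum_list)
  finally have "(\<Sum>p<length xs. single (xs ! p) (1::nat)) = (\<Sum>i\<in>#M. single i 1)" .
  moreover have "lookup (\<Sum>i\<in>#M. single i (1::nat)) j = count M j" for j
    by (induction M) (auto simp: lookup_add lookup_single when_def)
  moreover have "count M j = lookup a j" for j
    by (simp add: M_def count_sum sum.delta in_keys_iff)
  ultimately show "a = (\<Sum>p<length xs. single (xs ! p) 1)"
    by (intro poly_mapping_eqI) simp
qed

lemma card_facet:
  "pure_complex \<Delta> \<Longrightarrow> F \<in> facets \<Delta> \<Longrightarrow> int (card F) = complex_dim \<Delta> + 1"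
  by (auto simp: pure_complex_def)

text \<open>Write the exponent vector as a sorted word and colour position \<open>p\<close> by \<open>p mod k\<close>. Two adjacent
  or equal letters of the same colour would span a clique interval carrying more than \<open>k\<close> letters.\<close>

lemma monom_in_toric_ring_Ind:
  assumes \<Delta>: "unit_interval_complex n \<Delta>" and dim: "complex_dim \<Delta> = 1"
    and \<Gamma>: "\<Gamma> = Ind n \<Delta>"
    and wt: "\<And>u. (\<And>F. F \<in> \<Gamma> \<Longrightarrow> sum u F \<le> 1) \<Longrightarrow> wt u a \<le> k"
  shows "monom (single a c) k \<in> carrier (toric_ring \<Gamma>)"
proof (cases "k = 0")
  case True
  \<comment> \<open>With no colours available, weight 1 at a single vertex forces each exponent to
    vanish.\<close>
  have "lookup a i = 0" for i
  proof -
    have "wt (\<lambda>j. of_bool (i = j)) a \<le> k"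
    proof (rule wt)
      show "(\<Sum>j\<in>F. of_bool (i = j)) \<le> (1::nat)" for F
        by (cases "finite F") (simp_all add: of_bool_def sum.delta)
    qed
    moreover have "wt (\<lambda>j. of_bool (i = j)) a = lookup a i"
      by (auto simp: wt_def Int_insert_right in_keys_iff)
    ultimately show ?thesis using True by simp
  qed
  then have "a = 0" by (intro poly_mapping_eqI) simp
  with True show ?thesis
    using toric_ring_const[of c] by (simp add: const_def monom_0)
next
  case False
  obtain xs where xs: "sorted xs" "a = (\<Sum>p<length xs. single (xs ! p) 1)"
    by (rule exists_sorted_word)
  let ?N = "length xs"
  have wt_a: "wt u a = (\<Sum>p<?N. u (xs ! p))" for u
    by (simp add: xs(2) wt_sum wt_single)
  have facet_2: "card F = 2" if "F \<in> facets \<Delta>" for F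
    using card_facet[of \<Delta> F] \<Delta> dim that by (simp add: unit_interval_complex_def)
  have same_colour: "xs ! p \<noteq> xs ! q \<and> {xs ! p, xs ! q} \<notin> facets \<Delta>"
    if pq: "p < q" "q < ?N" "p mod k = q mod k" for p q
  proof -
    define C where "C = {xs ! p..xs ! q}"
    define u where "u = (\<lambda>i. of_bool (i \<in> C) :: nat)"
    \<comment> \<open>The difference is a positive multiple of k, so there are at least k + 1
      positions from p to q inclusive. All their letters lie in \<open>C\<close>, hence the weight
      of \<open>a\<close> exceeds k and \<open>u\<close> is not admissible.\<close>
    have "k \<le> q - p"
      using pq by (metis dvd_imp_le mod_eq_dvd_iff_nat less_imp_le zero_less_diff)
    then have "k < card {p..q}" using pq by simp
    also have "\<dots> = (\<Sum>r\<in>{p..q}. u (xs ! r))"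
      using pq xs(1) by (simp add: u_def C_def sorted_nth_mono)
    also have "\<dots> \<le> wt u a"
      unfolding wt_a using pq by (intro sum_mono2) auto
    finally obtain F where F: "F \<in> \<Gamma>" "\<not> sum u F \<le> (1::nat)"
      using wt[of u] by force
    \<comment> \<open>A sum over an infinite set is 0 by convention.\<close>
    have "finite F"
      using F(2) by (rule contrapos_np) simp
    then have "card (F \<inter> C) \<ge> 2"
      using F(2) by (simp add: u_def Int_def)
    then obtain i j where ij: "i \<in> F \<inter> C" "j \<in> F \<inter> C" "i \<noteq> j"
      using card_le_Suc0_iff_eq[of "F \<inter> C"] \<open>finite F\<close> by fastforce

    \<comment> \<open>If the end letters formed an edge, \<open>C\<close> would be a clique, and i,
      j would form an edge inside the independent set \<open>F\<close>. The end letters differ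
      because \<open>C\<close> has two elements.\<close>
    have "{xs ! p, xs ! q} \<notin> facets \<Delta>"
    proof
      assume "{xs ! p, xs ! q} \<in> facets \<Delta>"
      moreover have "xs ! p \<le> xs ! q" using pq xs(1) by (simp add: sorted_nth_mono)
      ultimately have "clique n \<Delta> C"
        using \<Delta> unfolding unit_interval_complex_def C_def by (fastforce simp: min_def max_def)
      then have "{i, j} \<in> facets \<Delta>"
        using ij dim unfolding clique_def by simp
      with ij F(1) show False by (auto simp: \<Gamma> Ind_def)
    qed
    moreover have "xs ! p \<noteq> xs ! q" using ij by (auto simp: C_def)
    ultimately show ?thesis by simp
  qed
  have range: "xs ! p \<in> {1..n}" if "p < ?N" for p
  proof (rule ccontr)
    assume p: "xs ! p \<notin> {1..n}"
    \<comment> \<open>A letter outside [n] lies in no member of \<Gamma>, so it may carry any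
      weight; \<open>Suc k\<close> already breaks the bound.\<close>
    define u where "u = (\<lambda>i. if i = xs ! p then Suc k else 0)"
    have "sum u F = 0" if "F \<in> \<Gamma>" for F
      using that p by (intro sum.neutral) (auto simp: u_def \<Gamma> Ind_def)
    then have "wt u a \<le> k" by (intro wt) simp
    moreover have "u (xs ! p) \<le> wt u a"
      unfolding wt_a using that by (intro member_le_sum) auto
    ultimately show False by (simp add: u_def)
  qed
  have indep: "(!) xs ` {p\<in>{..<?N}. p mod k = r} \<in> \<Gamma>" for r
  proof -
    have False if G: "G \<in> facets \<Delta>" "G \<subseteq> (!) xs ` {p\<in>{..<?N}. p mod k = r}" for G
    proof -
      obtain i j where ij: "G = {i, j}" "i \<noteq> j"
        using facet_2[OF G(1)] by (auto simp: card_2_iff)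
      obtain p where p: "i = xs ! p" "p < ?N" "p mod k = r"
        using G(2) ij(1) by auto
      obtain q where q: "j = xs ! q" "q < ?N" "q mod k = r"
        using G(2) ij(1) by auto
      have "p \<noteq> q"
        using p(1) q(1) ij(2) by auto
      then show False
        using same_colour[of p q] same_colour[of q p] G(1) p q ij(1)
        by (cases "p < q") (auto simp: insert_commute)
    qed
    then show ?thesis using range by (auto simp: \<Gamma> Ind_def)
  qed
  show ?thesis
    unfolding xs(2) using False same_colour indep
    by (intro monom_in_toric_ring_of_word) auto
qed

section \<open>Components of t-degree 0 and 1 in the toric ring\<close>

lemma lookup_sum_single: "finite F \<Longrightarrow> lookup (\<Sum>i\<in>F. single i 1) j = (if j \<in> F then 1 else 0)"
  by (simp add: lookup_sum lookup_single when_def sum.delta)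

lemma keys_sum_single: "finite F \<Longrightarrow> keys (\<Sum>i\<in>F. single i (1::nat)) = F"
  by (auto simp: in_keys_iff lookup_sum_single split: if_splits)

lemma keys_single_0_mult: "keys (single 0 c * s) \<subseteq> keys (s :: 'a::comm_monoid_add \<Rightarrow>\<^sub>0 'b::comm_semiring_0)"
  using keys_mult[of "single 0 c" s] by (auto split: if_splits)

lemma coeff_pCons_1: "coeff (pCons c p) 1 = coeff p 0"
  by (simp add: One_nat_def)

text \<open>Used to show that x_F t is outside the ring when F is not in \<Gamma>. The claim on
  degree 0 carries the induction: the degree 1 part of a product is then a scalar combination of the
  degree 1 parts of its factors.\<close>

lemma toric_ring_coeff_1:
  assumes "p \<in> carrier (toric_ring \<Gamma>)" and fin: "\<And>F. F \<in> \<Gamma> \<Longrightarrow> finite F"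
  shows "(\<exists>c. coeff p 0 = single 0 c) \<and> (\<forall>a\<in>keys (coeff p 1). keys a \<in> \<Gamma>)"
  using assms(1)
proof (induction rule: toric_ring_induct)
  case (const c)
  show ?case by (auto simp: const_def coeff_pCons_1)
next
  case (gen F)
  then show ?case
    using fin[OF gen] by (auto simp: t_var_mult coeff_pCons_1 x_prod_eq_single keys_sum_single intro: exI[of _ 0])
next
  case (uminus p)
  then show ?case by (auto simp: keys_minus simp flip: single_uminus)
next
  case (add p q)
  then show ?case
    using keys_add[of "coeff p 1" "coeff q 1"] by (auto simp flip: single_add)
next
  case (mult p q)
  then obtain c d where cd: "coeff p 0 = single 0 c" "coeff q 0 = single 0 d" by auto
  have "coeff (p * q) 1 = single 0 c * coeff q 1 + single 0 d * coeff p 1"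
    by (simp add: coeff_mult cd atMost_Suc One_nat_def mult.commute add.commute)
  then have "keys (coeff (p * q) 1) \<subseteq> keys (coeff q 1) \<union> keys (coeff p 1)"
    using keys_add keys_single_0_mult by (metis (no_types, lifting) Un_mono order_trans)
  then show ?case
    using mult by (auto simp: coeff_mult_0 cd mult_single)
qed

section \<open>Radicality of the ideal (t)\<close>

lemma exists_facet:
  assumes "simplicial_complex_on n \<Delta>" "\<Delta> \<noteq> {}"
  obtains F where "F \<in> facets \<Delta>"
proof -
  have "finite \<Delta>"
    using assms(1) by (auto simp: simplicial_complex_on_def intro: finite_subset)
  then obtain F where "F \<in> \<Delta>" "\<And>G. G \<in> \<Delta> \<Longrightarrow> F \<subseteq> G \<Longrightarrow> F = G"
    using finite_has_maximal[OF _ assms(2)] by auto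
  then show ?thesis by (intro that[of F]) (auto simp: facets_def)
qed

theorem corollary3p8:
  fixes n :: nat and \<Delta> \<Gamma> :: "nat set set" and R :: "'k::field S poly ring"
  assumes "unit_interval_complex n \<Delta>"
    and "complex_dim \<Delta> \<ge> 1"
    and "\<Gamma> = Ind n \<Delta>"
    and "R = toric_ring \<Gamma>"
  shows "radical_ideal (PIdl\<^bsub>R\<^esub> t_var) R \<longleftrightarrow> complex_dim \<Delta> = 1"
proof -
  note \<Gamma> = assms(3) and R = assms(4)
  interpret R: cring R unfolding R by (rule cring_toric_ring)
  have sc: "simplicial_complex_on n \<Delta>" and pure: "pure_complex \<Delta>"
    using assms(1) by (auto simp: unit_interval_complex_def)
  have card_f: "int (card F) = complex_dim \<Delta> + 1" if "F \<in> facets \<Delta>" for F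
    using card_facet pure that by blast
  have fin: "finite F" if "F \<in> \<Gamma>" for F
    using that by (auto simp: \<Gamma> Ind_def intro: finite_subset)
  have "{} \<in> \<Gamma>"
    using card_f assms(2) by (force simp: \<Gamma> Ind_def)
  then have t: "t_var \<in> carrier R"
    by (simp add: R t_var_in_toric_ring)
  have I: "ideal (PIdl\<^bsub>R\<^esub> t_var) R"
    using t by (rule R.cgenideal_ideal)
  have PIdl: "PIdl\<^bsub>R\<^esub> t_var = {p * t_var | p. p \<in> carrier R}"
    by (simp add: R PIdl_t_var)
  have pow: "x [^]\<^bsub>R\<^esub> (m::nat) = x ^ m" for x m
    by (simp add: R)
  show ?thesis
  proof
    assume dim: "complex_dim \<Delta> = 1"
    have "p \<in> PIdl\<^bsub>R\<^esub> t_var" if p: "p \<in> radical_of R (PIdl\<^bsub>R\<^esub> t_var)" for p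
    proof -
      from p obtain m g where p: "p \<in> carrier R" "p ^ m = g * t_var" "g \<in> carrier R"
        by (auto simp: radical_of_def PIdl pow)
      have wt: "wt u a < k"
        if "\<And>F. F \<in> \<Gamma> \<Longrightarrow> sum u F \<le> 1" "lookup (coeff p k) a \<noteq> 0" for u :: "nat \<Rightarrow> nat" and k a
        using wt_less_of_power_in_PIdl p that unfolding R by blast
      \<comment> \<open>The zero weight is admissible and gives 0 < k for every term of
        \<open>p\<close>.\<close>
      have "coeff p 0 = 0"
        using wt[of "\<lambda>_. 0" 0] by (intro poly_mapping_eqI) auto
      then obtain p' where p': "p = pCons 0 p'"
        by (cases p) auto
      have "monom (single a (lookup (coeff p' k) a)) k \<in> carrier R" if "a \<in> keys (coeff p' k)" for a k
        unfolding R
      proof (rule monom_in_toric_ring_Ind[OF assms(1) dim \<Gamma>])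
        fix u :: "nat \<Rightarrow> nat" assume "\<And>F. F \<in> \<Gamma> \<Longrightarrow> sum u F \<le> 1"
        \<comment> \<open>The term x^a t^k of \<open>p'\<close> is x^a t^(k+1) in \<open>p\<close>,
          so the strict bound there becomes a weak one here.\<close>
        then show "wt u a \<le> k"
          using wt[of u "Suc k" a] that by (simp add: p' in_keys_iff)
      qed
      then have "p' \<in> carrier R"
        unfolding R by (subst S_t_eq_sum_monom) (intro toric_ring_sum, auto)
      then show ?thesis by (auto simp: PIdl p' t_var_mult)
    qed
    moreover have "p \<in> radical_of R (PIdl\<^bsub>R\<^esub> t_var)" if "p \<in> PIdl\<^bsub>R\<^esub> t_var" for p
      using that ideal.Icarr[OF I that] by (auto simp: radical_of_def pow intro!: exI[of _ 1])
    ultimately show "radical_ideal (PIdl\<^bsub>R\<^esub> t_var) R"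
      using I by (auto simp: radical_ideal_def)
  next
    assume rad: "radical_ideal (PIdl\<^bsub>R\<^esub> t_var) R"
    show "complex_dim \<Delta> = 1"
    proof (rule ccontr)
      assume "complex_dim \<Delta> \<noteq> 1"
      with assms(2) have dim: "complex_dim \<Delta> \<ge> 2" by simp
      obtain F where F: "F \<in> facets \<Delta>"
        using exists_facet[OF sc] pure by (auto simp: pure_complex_def)
      have F_sub: "F \<subseteq> {1..n}"
        using F sc by (auto simp: facets_def simplicial_complex_on_def)
      then have [simp]: "finite F" by (rule finite_subset) simp
      \<comment> \<open>With three vertices, a pair {a, b} is a proper subset of \<open>F\<close>
        and therefore independent.\<close>
      have "card F \<ge> 3" using card_f[OF F] dim by simp
      then obtain G where "G \<subseteq> F" "card G = 2"
        using obtain_subset_with_card_n[of 2 F] by auto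
      then obtain a b where ab: "a \<in> F" "b \<in> F" "a \<noteq> b"
        by (auto simp: card_2_iff)
      \<comment> \<open>By purity every facet is as large as \<open>F\<close>, so none fits into
        \<open>G\<close>.\<close>
      have small: "G \<in> \<Gamma>" if "G \<subseteq> F" "card G < card F" for G
      proof -
        have "\<not> H \<subseteq> G" if "H \<in> facets \<Delta>" for H
          using card_f[OF that] card_f[OF F] card_mono[of G H] \<open>card G < card F\<close>
            finite_subset[OF \<open>G \<subseteq> F\<close>] by auto
        with \<open>G \<subseteq> F\<close> F_sub show ?thesis by (auto simp: \<Gamma> Ind_def)
      qed
      have x_split: "x_prod F = (x_var i * x_prod (F - {i}) :: 'k S)" if "i \<in> F" for i
        unfolding x_prod_def using that by (simp add: prod.remove)
      have x_prod_singleton: "x_prod {i} = (x_var i :: 'k S)" for i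
        by (simp add: x_prod_def)
      have "x_prod F * x_prod F = (x_var a * x_prod (F - {a})) * (x_var b * x_prod (F - {b}) :: 'k S)"
        by (simp only: x_split[OF ab(1)] flip: x_split[OF ab(2)])
      also have "\<dots> = x_prod (F - {a}) * x_prod (F - {b}) * x_prod {a, b}"
        using ab(3) by (simp add: x_prod_def mult_ac)
      finally have x_square:
        "x_prod F * x_prod F = (x_prod (F - {a}) * x_prod (F - {b}) * x_prod {a, b} :: 'k S)" .
      let ?X = "\<lambda>G. [:x_prod G:] * t_var :: 'k S poly"
      have X: "?X G \<in> carrier R" if "G \<subseteq> F" "card G < card F" for G
        unfolding R using small[OF that] by (rule toric_ring_gen)
      have Xs: "?X {a} \<in> carrier R" "?X (F - {a}) \<in> carrier R" "?X (F - {b}) \<in> carrier R"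
          "?X {a, b} \<in> carrier R"
        using ab \<open>card F \<ge> 3\<close> by (intro X; simp add: card_Diff_singleton_if)+
      define z :: "'k S poly" where "z = ?X F * t_var"
      have "z = ?X {a} * ?X (F - {a})"
        by (simp add: z_def x_split[OF ab(1)] x_prod_singleton t_var_mult mult.commute)
      also have "\<dots> \<in> carrier R"
        using Xs unfolding R by (blast intro: toric_ring_mult)
      finally have z: "z \<in> carrier R" .
      have "z ^ 2 = (?X (F - {a}) * ?X (F - {b}) * ?X {a, b}) * t_var"
        using x_square by (simp add: z_def power2_eq_square t_var_mult mult.commute)
      moreover have "?X (F - {a}) * ?X (F - {b}) * ?X {a, b} \<in> carrier R"
        using Xs unfolding R by (blast intro: toric_ring_mult)
      ultimately have "z ^ 2 \<in> PIdl\<^bsub>R\<^esub> t_var"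
        unfolding PIdl by blast
      with z have "z \<in> radical_of R (PIdl\<^bsub>R\<^esub> t_var)"
        by (auto simp: radical_of_def pow intro!: exI[of _ 2])
      with rad obtain y where "y \<in> carrier R" "z = y * t_var"
        by (auto simp: radical_ideal_def PIdl)
      \<comment> \<open>Cancelling t in S[t] leaves x_F t = y, an element of degree 1 whose support
        must be independent.\<close>
      then have "?X F \<in> carrier R"
        by (simp add: z_def t_var_mult)
      then have "F \<in> \<Gamma>"
        using toric_ring_coeff_1[of "?X F" \<Gamma>] fin
        by (simp add: R t_var_mult coeff_pCons_1 x_prod_eq_single keys_sum_single)
      with F show False by (auto simp: \<Gamma> Ind_def)
    qed
  qed
qed

end
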